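(* For each $n\geq 1$ let $X_{n,1},\ldots,X_{n,n}$ be independent random variables on a probability space $(\Omega,\mathcal{F},P)$ such that $X_{n,k}$ is geometrically distributed with parameter $p_{n,k}:=1-\frac{k-1}{n}$, i.e. $$P(X_{n,k}=h)=(1-p_{n,k})^{h-1}p_{n,k}\quad\text{for all integers }h\geq 1$$ (with $0^0=1$), and let $T_n:=\sum_{k=1}^nX_{n,k}$. Then, for every family of positive numbers $\{a_n\}$ such that $a_n\to 0$ and $a_n\log n\to\infty$ as $n\to\infty$, the sequence of random variables $\left\{a_n\log n\left(\frac{T_n}{n\log n}-1\right):n\geq 2\right\}$ satisfies the large deviation principle with speed $1/a_n$ and rate function $I_{\mathrm{MD}}:\mathbb{R}\to[0,\infty]$ defined by $$I_{\mathrm{MD}}(x):=\begin{cases}x&\text{if }x\in[0,\infty)\\ \infty&\text{otherwise.}\end{cases}$$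
   Context: Large deviation principle (LDP): a speed is a sequence $\{v_n\}$ with $v_n\to\infty$; a rate function on $\mathbb{R}$ is a lower semicontinuous function $I:\mathbb{R}\to[0,\infty]$ (its level sets are not required to be compact in the definition). A sequence $\{Z_n\}$ of real random variables satisfies the LDP with speed $v_n$ and rate function $I$ if $$\limsup_{n\to\infty}\frac{1}{v_n}\log P(Z_n\in C)\leq-\inf_{x\in C}I(x)\quad\text{for all closed sets }C\subset\mathbb{R},$$ $$\liminf_{n\to\infty}\frac{1}{v_n}\log P(Z_n\in O)\geq-\inf_{x\in O}I(x)\quad\text{for all open sets }O\subset\mathbb{R},$$ with the conventions $\log 0=-\infty$ and $\inf\emptyset=\infty$. ($T_n$ is the number of draws needed in the coupon collector's problem with $n$ equally likely coupon types.) *)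

theory Defs
  imports "HOL-Probability.Probability"
begin

text \<open>Logarithm of a probability with the convention \<open>log 0 = -\<infinity>\<close>
  (the library has \<open>ln 0 = 0\<close>).\<close>

definition elog :: "real \<Rightarrow> ereal" where
  "elog p = (if p = 0 then -\<infinity> else ereal (ln p))"

definition lower_semicontinuous :: "(real \<Rightarrow> ereal) \<Rightarrow> bool" where
  "lower_semicontinuous f \<longleftrightarrow> (\<forall>c. closed {x. f x \<le> c})"

definition rate_function :: "(real \<Rightarrow> ereal) \<Rightarrow> bool" where
  "rate_function I \<longleftrightarrow> (\<forall>x. 0 \<le> I x) \<and> lower_semicontinuous I"

text \<open>The sequence is indexed by \<open>n \<ge> n\<^sub>0\<close>; values below \<open>n\<^sub>0\<close> play no role.
  The convention \<open>inf \<emptyset> = \<infinity>\<close> holds for \<open>INF\<close> on \<^typ>\<open>ereal\<close>.\<close>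

definition satisfies_LDP ::
  "'a measure \<Rightarrow> nat \<Rightarrow> (nat \<Rightarrow> 'a \<Rightarrow> real) \<Rightarrow> (nat \<Rightarrow> real) \<Rightarrow> (real \<Rightarrow> ereal) \<Rightarrow> bool" where
  "satisfies_LDP M n\<^sub>0 Z v I \<longleftrightarrow>
     (\<forall>n\<ge>n\<^sub>0. Z n \<in> borel_measurable M) \<and>
     filterlim v at_top sequentially \<and>
     rate_function I \<and>
     (\<forall>C. closed C \<longrightarrow>
        limsup (\<lambda>n. ereal (1 / v n) * elog (measure M {\<omega> \<in> space M. Z n \<omega> \<in> C}))
          \<le> - (INF x\<in>C. I x)) \<and>
     (\<forall>U. open U \<longrightarrow>
        - (INF x\<in>U. I x)
          \<le> liminf (\<lambda>n. ereal (1 / v n) * elog (measure M {\<omega> \<in> space M. Z n \<omega> \<in> U})))"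

text \<open>Geometric law on \<open>{1, 2, \<dots>}\<close> (the library's \<^const>\<open>geometric_pmf\<close> starts at 0).\<close>

definition geometrically_distributed :: "'a measure \<Rightarrow> ('a \<Rightarrow> real) \<Rightarrow> real \<Rightarrow> bool" where
  "geometrically_distributed M Y p \<longleftrightarrow>
     Y \<in> borel_measurable M \<and>
     (\<forall>h::nat. h \<ge> 1 \<longrightarrow>
        measure M {\<omega> \<in> space M. Y \<omega> = real h} = (1 - p) ^ (h - 1) * p)"

definition coupon_p :: "nat \<Rightarrow> nat \<Rightarrow> real" where
  "coupon_p n k = 1 - (real k - 1) / real n"

definition coupon_T :: "(nat \<Rightarrow> nat \<Rightarrow> 'a \<Rightarrow> real) \<Rightarrow> nat \<Rightarrow> 'a \<Rightarrow> real" where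
  "coupon_T X n \<omega> = (\<Sum>k=1..n. X n k \<omega>)"

definition I_MD :: "real \<Rightarrow> ereal" where
  "I_MD x = (if 0 \<le> x then ereal x else \<infinity>)"

end

theory Submission
  imports Defs "HOL-Real_Asymp.Real_Asymp"
begin

text \<open>For \<open>\<theta> < 1\<close> the exponential moment of \<open>T\<^sub>n / n\<close> is at most
  \<open>\<Prod>j=1..n. j / (j - \<theta>)\<close>, which is of order \<open>n powr \<theta>\<close>. Markov's inequality with
  \<open>\<theta>\<close> close to \<open>1\<close> gives the upper tail \<open>exp (- \<theta> * y)\<close> of \<open>T\<^sub>n / n - ln n\<close>, and with
  \<open>\<theta> = - t\<close>, \<open>t\<close> an arbitrarily large integer, it shows that the lower tail is negligible.
  For the lower bound, the summand of parameter \<open>1 / n\<close> alone makes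
  \<open>T\<^sub>n / n - ln n\<close> exceed \<open>y\<close> with probability of order \<open>exp (- y)\<close>, and the upper tail bound
  confines this mass to a small interval.\<close>

section \<open>Geometric variables: values, exponential moments and tails\<close>

lemma geometrically_distributed_prob_Suc:
  assumes "geometrically_distributed M Y p"
  shows "measure M {\<omega> \<in> space M. Y \<omega> = real (Suc i)} = (1 - p) ^ i * p"
  using assms unfolding geometrically_distributed_def
  by (metis One_nat_def diff_Suc_1 le_add1 plus_1_eq_Suc)

text \<open>The definition fixes only point masses at positive integers. As these masses already sum
  to 1, nothing is left for other values.\<close>

lemma (in prob_space) geometric_AE_values:
  assumes Y: "geometrically_distributed M Y p" and p: "0 < p" "p \<le> 1"
  shows "AE \<omega> in M. \<exists>i. Y \<omega> = real (Suc i)"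
proof -
  have [measurable]: "Y \<in> borel_measurable M"
    using Y by (simp add: geometrically_distributed_def)
  define A where "A i = {\<omega> \<in> space M. Y \<omega> = real (Suc i)}" for i
  have A: "A i \<in> events" for i unfolding A_def by measurable
  have "disjoint_family A" by (auto simp: disjoint_family_on_def A_def)
  then have "(\<lambda>i. prob (A i)) sums prob (\<Union>i. A i)"
    using A by (intro finite_measure_UNION) auto
  moreover have "prob (A i) = (1 - p) ^ i * p" for i
    unfolding A_def by (rule geometrically_distributed_prob_Suc[OF Y])
  moreover have "(\<lambda>i. (1 - p) ^ i * p) sums (1 / (1 - (1 - p)) * p)"
    using p by (intro sums_mult2 geometric_sums) auto
  ultimately have "prob (\<Union>i. A i) = 1"
    using p sums_unique2 by fastforce
  then have "AE \<omega> in M. \<omega> \<in> (\<Union>i. A i)"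
    using A by (intro AE_prob_1)
  then show ?thesis by eventually_elim (auto simp: A_def)
qed

text \<open>The exact moment is a geometric series, and \<open>1 - s \<le> exp (- s)\<close> weakens
  it to the transform \<open>p / (p - s)\<close> of an exponential variable of rate
  \<open>p\<close>. This form depends only on the ratio of \<open>s\<close> to \<open>p\<close>. The
  same inequality with \<open>s < p\<close> makes the series converge.\<close>

lemma (in prob_space) geometric_exp_moment_le:
  assumes Y: "geometrically_distributed M Y p" and p: "0 < p" "p \<le> 1" and s: "s < p"
  shows "(\<integral>\<^sup>+\<omega>. ennreal (exp (s * Y \<omega>)) \<partial>M) \<le> ennreal (p / (p - s))"
proof -
  have [measurable]: "Y \<in> borel_measurable M"
    using Y by (simp add: geometrically_distributed_def)
  define A where "A i = {\<omega> \<in> space M. Y \<omega> = real (Suc i)}" for i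
  have [measurable]: "A i \<in> events" for i unfolding A_def by measurable
  have PA: "prob (A i) = (1 - p) ^ i * p" for i
    unfolding A_def by (rule geometrically_distributed_prob_Suc[OF Y])
  have "1 - s \<le> exp (- s)" using exp_ge_add_one_self[of "- s"] by simp
  then have es: "(1 - s) * exp s \<le> 1"
    by (simp add: exp_minus field_simps)
  have "(1 - p) * exp s < (1 - s) * exp s" using s by simp
  with es have q1: "exp s * (1 - p) < 1" by (simp only: mult.commute)
  have q0: "0 \<le> exp s * (1 - p)" using p by simp
  have "(\<integral>\<^sup>+\<omega>. ennreal (exp (s * Y \<omega>)) \<partial>M) =
      (\<integral>\<^sup>+\<omega>. (\<Sum>i. ennreal (exp (s * real (Suc i))) * indicator (A i) \<omega>) \<partial>M)"
  proof (rule nn_integral_cong_AE)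
    show "AE \<omega> in M. ennreal (exp (s * Y \<omega>)) =
      (\<Sum>i. ennreal (exp (s * real (Suc i))) * indicator (A i) \<omega>)"
      using geometric_AE_values[OF Y p] AE_space
    proof eventually_elim
      case (elim \<omega>)
      then obtain j where j: "Y \<omega> = real (Suc j)" by auto
      have "(\<Sum>i. ennreal (exp (s * real (Suc i))) * indicator (A i) \<omega>)
          = (\<Sum>i\<in>{j}. ennreal (exp (s * real (Suc i))) * indicator (A i) \<omega>)"
        using j by (intro suminf_finite) (auto simp: A_def)
      also have "\<dots> = ennreal (exp (s * Y \<omega>))"
        using j elim by (simp add: A_def)
      finally show ?case by simp
    qed
  qed
  also have "\<dots> = (\<Sum>i. ennreal (exp (s * real (Suc i))) * emeasure M (A i))"
    by (subst nn_integral_suminf) (auto simp: nn_integral_cmult_indicator)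
  also have "\<dots> = (\<Sum>i. ennreal (p * exp s * (exp s * (1 - p)) ^ i))"
  proof (rule suminf_cong)
    fix i
    have "exp (s * real (Suc i)) = exp s * exp s ^ i"
      by (simp add: exp_of_nat_mult[symmetric] exp_add[symmetric] algebra_simps)
    then show "ennreal (exp (s * real (Suc i))) * emeasure M (A i)
        = ennreal (p * exp s * (exp s * (1 - p)) ^ i)"
      using p by (simp add: emeasure_eq_measure PA ennreal_mult[symmetric] power_mult_distrib
          mult_ac del: of_nat_Suc)
  qed
  also have "\<dots> = ennreal (p * exp s * (1 / (1 - exp s * (1 - p))))"
    using p q0 q1
    by (intro suminf_ennreal_eq sums_mult geometric_sums) (auto intro!: mult_nonneg_nonneg)
  also have "\<dots> \<le> ennreal (p / (p - s))"
  proof (rule ennreal_leI)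
    have "p * ((p - s) * exp s) \<le> p * (1 - exp s * (1 - p))"
      using es p by (intro mult_left_mono) (auto simp: algebra_simps)
    then show "p * exp s * (1 / (1 - exp s * (1 - p))) \<le> p / (p - s)"
      using q1 s by (simp add: field_simps)
  qed
  finally show ?thesis .
qed

text \<open>Almost surely, the complement means that \<open>Y\<close> takes one of the values
  \<open>1, ..., m\<close>; their masses sum to \<open>1 - (1 - p) ^ m\<close>.\<close>

lemma (in prob_space) geometric_tail_ge:
  assumes Y: "geometrically_distributed M Y p" and p: "0 < p" "p \<le> 1"
  shows "(1 - p) ^ m \<le> prob {\<omega> \<in> space M. real m + 1 \<le> Y \<omega>}"
proof -
  have [measurable]: "Y \<in> borel_measurable M"
    using Y by (simp add: geometrically_distributed_def)
  define A where "A i = {\<omega> \<in> space M. Y \<omega> = real (Suc i)}" for i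
  have A: "A i \<in> events" for i unfolding A_def by measurable
  have PA: "prob (A i) = (1 - p) ^ i * p" for i
    unfolding A_def by (rule geometrically_distributed_prob_Suc[OF Y])
  have "prob {\<omega> \<in> space M. \<not> real m + 1 \<le> Y \<omega>} \<le> prob (\<Union>i\<in>{..<m}. A i)"
  proof (rule finite_measure_mono_AE)
    show "AE \<omega> in M. \<omega> \<in> {\<omega> \<in> space M. \<not> real m + 1 \<le> Y \<omega>} \<longrightarrow> \<omega> \<in> (\<Union>i\<in>{..<m}. A i)"
      using geometric_AE_values[OF Y p] by eventually_elim (auto simp: A_def)
  qed (use A in auto)
  also have "\<dots> \<le> (\<Sum>i<m. prob (A i))"
    using A by (intro finite_measure_subadditive_finite) auto
  also have "\<dots> = 1 - (1 - p) ^ m"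
    using p by (simp add: PA sum_distrib_right[symmetric] sum_gp_strict)
  finally show ?thesis
    by (subst (asm) prob_neg) auto
qed

section \<open>Exponential moments of partial coupon sums and Markov's inequality\<close>

lemma (in prob_space) coupon_exp_moment_le:
  fixes X :: "nat \<Rightarrow> 'a \<Rightarrow> real"
  assumes ind: "indep_vars (\<lambda>_. borel) X {1..n}"
    and geo: "\<And>k. k \<in> {1..n} \<Longrightarrow> geometrically_distributed M (X k) (coupon_p n k)"
    and J: "J \<subseteq> {1..n}" and \<theta>: "\<And>k. k \<in> J \<Longrightarrow> \<theta> < real (n + 1 - k)"
  shows "(\<integral>\<^sup>+\<omega>. ennreal (exp (\<theta> / real n * (\<Sum>k\<in>J. X k \<omega>))) \<partial>M)
    \<le> ennreal (\<Prod>k\<in>J. real (n + 1 - k) / (real (n + 1 - k) - \<theta>))"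
proof -
  have fin: "finite J" using J finite_subset by blast
  have indJ: "indep_vars (\<lambda>_. borel) (\<lambda>k \<omega>. ennreal (exp (\<theta> / real n * X k \<omega>))) J"
    by (rule indep_vars_compose2[OF indep_vars_subset[OF ind J]]) simp
  have "(\<integral>\<^sup>+\<omega>. ennreal (exp (\<theta> / real n * (\<Sum>k\<in>J. X k \<omega>))) \<partial>M)
      = (\<integral>\<^sup>+\<omega>. (\<Prod>k\<in>J. ennreal (exp (\<theta> / real n * X k \<omega>))) \<partial>M)"
    by (simp add: sum_distrib_left exp_sum[OF fin] prod_ennreal)
  also have "\<dots> = (\<Prod>k\<in>J. \<integral>\<^sup>+\<omega>. ennreal (exp (\<theta> / real n * X k \<omega>)) \<partial>M)"
    by (rule indep_vars_nn_integral[OF fin indJ]) auto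
  also have "\<dots> \<le> (\<Prod>k\<in>J. ennreal (real (n + 1 - k) / (real (n + 1 - k) - \<theta>)))"
  proof (rule prod_mono_ennreal)
    fix k assume k: "k \<in> J"
    then have kn: "1 \<le> k" "k \<le> n" using J by auto
    \<comment> \<open>With \<open>j = n + 1 - k\<close> the parameter is \<open>j / n\<close>, so at
      \<open>s = \<theta> / n\<close> the scale \<open>n\<close> cancels and the factor becomes
      \<open>j / (j - \<theta>)\<close>.\<close>
    have pk: "coupon_p n k = real (n + 1 - k) / real n"
      using kn by (simp add: coupon_p_def field_simps of_nat_diff)
    have "(\<integral>\<^sup>+\<omega>. ennreal (exp (\<theta> / real n * X k \<omega>)) \<partial>M)
       \<le> ennreal (coupon_p n k / (coupon_p n k - \<theta> / real n))"
      using kn \<theta>[OF k] by (intro geometric_exp_moment_le geo) (auto simp: pk field_simps)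
    also have "coupon_p n k / (coupon_p n k - \<theta> / real n)
        = real (n + 1 - k) / (real (n + 1 - k) - \<theta>)"
      using kn by (simp add: pk diff_divide_distrib[symmetric])
    finally show "(\<integral>\<^sup>+\<omega>. ennreal (exp (\<theta> / real n * X k \<omega>)) \<partial>M)
       \<le> ennreal (real (n + 1 - k) / (real (n + 1 - k) - \<theta>))" .
  qed
  also have "\<dots> = ennreal (\<Prod>k\<in>J. real (n + 1 - k) / (real (n + 1 - k) - \<theta>))"
  proof (rule prod_ennreal)
    fix k assume "k \<in> J"
    from \<theta>[OF this] show "0 \<le> real (n + 1 - k) / (real (n + 1 - k) - \<theta>)"
      by (intro divide_nonneg_nonneg) auto
  qed
  finally show ?thesis .
qed

text \<open>The sign of \<open>s\<close> is left free: a nonnegative \<open>s\<close> serves upper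
  tails, a negative one lower tails.\<close>

lemma (in prob_space) prob_exp_Markov:
  assumes [measurable]: "W \<in> borel_measurable M"
    and le: "(\<integral>\<^sup>+\<omega>. ennreal (exp (s * W \<omega>)) \<partial>M) \<le> ennreal B" and B: "0 \<le> B"
  shows "prob {\<omega> \<in> space M. u \<le> s * W \<omega>} \<le> exp (- u) * B"
proof -
  have "emeasure M {\<omega> \<in> space M. u \<le> s * W \<omega>} =
      emeasure M ({\<omega> \<in> space M. 1 \<le> ennreal (exp (- u)) * ennreal (exp (s * W \<omega>))} \<inter> space M)"
    by (intro arg_cong[where f = "emeasure M"])
       (auto simp: ennreal_mult[symmetric] exp_add[symmetric] simp flip: ennreal_1)
  also have "\<dots> \<le> ennreal (exp (- u)) *
      (\<integral>\<^sup>+\<omega>. ennreal (exp (s * W \<omega>)) * indicator (space M) \<omega> \<partial>M)"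
    by (rule order_trans[OF _ nn_integral_Markov_inequality]) (auto intro!: emeasure_mono)
  also have "\<dots> = ennreal (exp (- u)) * (\<integral>\<^sup>+\<omega>. ennreal (exp (s * W \<omega>)) \<partial>M)"
    by (intro arg_cong2[where f = "(*)"] nn_integral_cong refl) simp
  also have "\<dots> \<le> ennreal (exp (- u)) * ennreal B"
    by (intro mult_left_mono le) simp
  finally show ?thesis
    using B by (simp add: emeasure_eq_measure ennreal_mult[symmetric])
qed

section \<open>Growth of the products of ratios\<close>

lemma prod_ratio_le_powr:
  fixes \<theta> :: real
  assumes \<theta>: "0 \<le> \<theta>" "\<theta> < 1" and n: "n \<ge> 1"
  shows "(\<Prod>j=1..n. real j / (real j - \<theta>)) \<le> real n powr \<theta> / (1 - \<theta>)"
  using n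
proof (induction n rule: dec_induct)
  case base
  then show ?case using \<theta> by simp
next
  case (step n)
  define m where "m = real (Suc n)"
  have m: "m > 1" "real n = m - 1" using step by (auto simp: m_def)
  \<comment> \<open>By Young's inequality with weights \<open>\<theta>\<close> and
    \<open>1 - \<theta>\<close>, \<open>(1 - 1 / m) powr \<theta> \<le> 1 - \<theta> / m\<close>.
    Hence each new factor \<open>m / (m - \<theta>)\<close> is at most
    \<open>(m / (m - 1)) powr \<theta>\<close>, and these telescope. The constant
    \<open>1 / (1 - \<theta>)\<close> is the factor \<open>j = 1\<close>.\<close>
  have "(m - 1) powr \<theta> / m powr \<theta> = (1 + - 1 / m) powr \<theta>"
    using m by (simp add: powr_divide[symmetric] field_simps)
  also have "\<dots> \<le> 1 + \<theta> * (- 1 / m)"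
    using Youngs_inequality_0[of \<theta> "1 - \<theta>" "1 + - 1 / m" 1] \<theta> m by (simp add: algebra_simps)
  finally have "(m - 1) powr \<theta> * m \<le> m powr \<theta> * (m - \<theta>)"
    using m by (simp add: field_simps)
  then have *: "(m - 1) powr \<theta> * (m / (m - \<theta>)) \<le> m powr \<theta>"
    using m \<theta> by (simp add: field_simps)
  have "(\<Prod>j=1..Suc n. real j / (real j - \<theta>))
      = (\<Prod>j=1..n. real j / (real j - \<theta>)) * (m / (m - \<theta>))"
    using step by (simp add: m_def)
  also have "\<dots> \<le> real n powr \<theta> / (1 - \<theta>) * (m / (m - \<theta>))"
    using m \<theta> by (intro mult_right_mono step.IH) auto
  also have "\<dots> = (m - 1) powr \<theta> * (m / (m - \<theta>)) / (1 - \<theta>)"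
    by (simp add: m)
  also have "\<dots> \<le> m powr \<theta> / (1 - \<theta>)"
    using * \<theta> by (intro divide_right_mono) auto
  finally show ?case by (simp add: m_def)
qed

text \<open>The quotient \<open>fact (n + t) / fact n\<close> is a product of \<open>t\<close>
  factors, each larger than \<open>n\<close>.\<close>

lemma power_mult_fact_le: "n ^ t * fact n \<le> (fact (n + t) :: nat)"
proof (induction t)
  case (Suc t)
  have "n ^ Suc t * fact n = n * (n ^ t * fact n)" by simp
  also have "\<dots> \<le> Suc (n + t) * fact (n + t)" by (intro mult_mono Suc) auto
  finally show ?case by simp
qed simp

text \<open>Integer shifts are used for the lower tail because the product then collapses to the
  reciprocal of a binomial coefficient.\<close>

lemma prod_ratio_add_nat:
  "(\<Prod>j=1..n. real j / (real j + real t)) = fact n * fact t / fact (n + t)"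
proof (induction n)
  case (Suc n)
  then show ?case by (simp add: divide_simps) (simp add: algebra_simps)
qed simp

lemma prod_ratio_add_nat_le:
  assumes "n \<ge> 1"
  shows "(\<Prod>j=1..n. real j / (real j + real t)) \<le> fact t / real n ^ t"
proof -
  have "real (n ^ t * fact n) \<le> real (fact (n + t))"
    using power_mult_fact_le of_nat_le_iff by blast
  then have "real n ^ t * fact n * fact t \<le> fact (n + t) * fact t"
    by (intro mult_right_mono) auto
  then show ?thesis using assms
    unfolding prod_ratio_add_nat by (simp add: field_simps)
qed

section \<open>The rate function\<close>

lemma rate_function_I_MD: "rate_function I_MD"
proof -
  have "closed {x. I_MD x \<le> c}" for c
  proof (cases c)
    case (real r)
    then have "{x. I_MD x \<le> c} = {0..r}" by (auto simp: I_MD_def split: if_splits)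
    then show ?thesis by simp
  next
    case PInf
    then show ?thesis by simp
  next
    case MInf
    then have "{x. I_MD x \<le> c} = {}" by (auto simp: I_MD_def)
    then show ?thesis by simp
  qed
  then show ?thesis
    by (auto simp: rate_function_def lower_semicontinuous_def I_MD_def)
qed

section \<open>Tail bounds for the coupon sum\<close>

lemma prod_coupon_reindex:
  fixes f :: "nat \<Rightarrow> 'b :: comm_monoid_mult"
  shows "(\<Prod>k\<in>{1..n}. f (n + 1 - k)) = (\<Prod>j=1..n. f j)"
  using prod.atLeastAtMost_rev[of f 1 n] by simp

text \<open>In Markov's inequality at \<open>\<theta> / n\<close>, the order
  \<open>n powr \<theta>\<close> of the moment cancels against the contribution
  \<open>exp (- (\<theta> * ln n))\<close> of the centering.\<close>

lemma (in prob_space) coupon_sum_upper_tail: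
  fixes X :: "nat \<Rightarrow> 'a \<Rightarrow> real"
  assumes n: "n \<ge> 1" and ind: "indep_vars (\<lambda>_. borel) X {1..n}"
    and geo: "\<And>k. k \<in> {1..n} \<Longrightarrow> geometrically_distributed M (X k) (coupon_p n k)"
    and \<theta>: "0 \<le> \<theta>" "\<theta> < 1"
  shows "prob {\<omega> \<in> space M. real n * (ln (real n) + y) \<le> (\<Sum>k=1..n. X k \<omega>)}
    \<le> exp (- (\<theta> * y)) / (1 - \<theta>)"
proof -
  have [measurable]: "\<And>k. k \<in> {1..n} \<Longrightarrow> X k \<in> borel_measurable M"
    using geo by (simp add: geometrically_distributed_def)
  have "(\<integral>\<^sup>+\<omega>. ennreal (exp (\<theta> / real n * (\<Sum>k=1..n. X k \<omega>))) \<partial>M)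
      \<le> ennreal (\<Prod>k\<in>{1..n}. real (n + 1 - k) / (real (n + 1 - k) - \<theta>))"
    using \<theta> by (intro coupon_exp_moment_le ind geo) (auto simp: of_nat_diff)
  also have "\<dots> \<le> ennreal (real n powr \<theta> / (1 - \<theta>))"
    by (subst prod_coupon_reindex[of "\<lambda>j. real j / (real j - \<theta>)"])
       (intro ennreal_leI prod_ratio_le_powr \<theta> n)
  finally have mom: "(\<integral>\<^sup>+\<omega>. ennreal (exp (\<theta> / real n * (\<Sum>k=1..n. X k \<omega>))) \<partial>M)
      \<le> ennreal (real n powr \<theta> / (1 - \<theta>))" .
  have "prob {\<omega> \<in> space M. real n * (ln (real n) + y) \<le> (\<Sum>k=1..n. X k \<omega>)}
     \<le> prob {\<omega> \<in> space M. \<theta> * (ln (real n) + y) \<le> \<theta> / real n * (\<Sum>k=1..n. X k \<omega>)}"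
  \<comment> \<open>Only an inclusion holds in general: for \<open>\<theta> = 0\<close> the
    right-hand event is the whole space.\<close>
  proof (rule finite_measure_mono)
    show "{\<omega> \<in> space M. real n * (ln (real n) + y) \<le> (\<Sum>k=1..n. X k \<omega>)}
      \<subseteq> {\<omega> \<in> space M. \<theta> * (ln (real n) + y) \<le> \<theta> / real n * (\<Sum>k=1..n. X k \<omega>)}"
    proof safe
      fix \<omega> assume "real n * (ln (real n) + y) \<le> (\<Sum>k=1..n. X k \<omega>)"
      then have "\<theta> / real n * (real n * (ln (real n) + y)) \<le> \<theta> / real n * (\<Sum>k=1..n. X k \<omega>)"
        using \<theta> by (intro mult_left_mono) auto
      then show "\<theta> * (ln (real n) + y) \<le> \<theta> / real n * (\<Sum>k=1..n. X k \<omega>)"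
        using n by simp
    qed
  qed measurable
  also have "\<dots> \<le> exp (- (\<theta> * (ln (real n) + y))) * (real n powr \<theta> / (1 - \<theta>))"
    using \<theta> by (intro prob_exp_Markov mom) auto
  also have "\<dots> = exp (- (\<theta> * y)) / (1 - \<theta>)"
    using n by (simp add: powr_def exp_add[symmetric] algebra_simps)
  finally show ?thesis .
qed

text \<open>Markov's inequality at the negative exponent \<open>- t / n\<close>; the power
  \<open>n ^ t\<close> comes from \<open>exp (t * ln n)\<close>. The index set \<open>J\<close> is
  kept general so that the last summand can later be left out.\<close>

lemma (in prob_space) coupon_sum_lower_tail:
  fixes X :: "nat \<Rightarrow> 'a \<Rightarrow> real"
  assumes n: "n \<ge> 1" and ind: "indep_vars (\<lambda>_. borel) X {1..n}"
    and geo: "\<And>k. k \<in> {1..n} \<Longrightarrow> geometrically_distributed M (X k) (coupon_p n k)"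
    and J: "J \<subseteq> {1..n}"
  shows "prob {\<omega> \<in> space M. (\<Sum>k\<in>J. X k \<omega>) \<le> real n * (ln (real n) - y)}
    \<le> exp (- (real t * y)) * (real n ^ t * (\<Prod>k\<in>J. real (n + 1 - k) / (real (n + 1 - k) + real t)))"
proof -
  have [measurable]: "\<And>k. k \<in> J \<Longrightarrow> X k \<in> borel_measurable M"
    using geo J by (auto simp: geometrically_distributed_def)
  let ?B = "\<Prod>k\<in>J. real (n + 1 - k) / (real (n + 1 - k) + real t)"
  have mom: "(\<integral>\<^sup>+\<omega>. ennreal (exp (- real t / real n * (\<Sum>k\<in>J. X k \<omega>))) \<partial>M) \<le> ennreal ?B"
    using coupon_exp_moment_le[OF ind geo J, of "- real t"] J by (force simp: of_nat_diff)
  have "prob {\<omega> \<in> space M. (\<Sum>k\<in>J. X k \<omega>) \<le> real n * (ln (real n) - y)}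
     \<le> prob {\<omega> \<in> space M. - real t * (ln (real n) - y) \<le> - real t / real n * (\<Sum>k\<in>J. X k \<omega>)}"
  proof (rule finite_measure_mono)
    show "{\<omega> \<in> space M. (\<Sum>k\<in>J. X k \<omega>) \<le> real n * (ln (real n) - y)}
      \<subseteq> {\<omega> \<in> space M. - real t * (ln (real n) - y) \<le> - real t / real n * (\<Sum>k\<in>J. X k \<omega>)}"
    proof safe
      fix \<omega> assume "(\<Sum>k\<in>J. X k \<omega>) \<le> real n * (ln (real n) - y)"
      then have "- real t / real n * (real n * (ln (real n) - y)) \<le> - real t / real n * (\<Sum>k\<in>J. X k \<omega>)"
        by (intro mult_left_mono_neg) auto
      then show "- real t * (ln (real n) - y) \<le> - real t / real n * (\<Sum>k\<in>J. X k \<omega>)"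
        using n by simp
    qed
  qed measurable
  also have "\<dots> \<le> exp (- (- real t * (ln (real n) - y))) * ?B"
    by (intro prob_exp_Markov mom prod_nonneg) auto
  also have "exp (- (- real t * (ln (real n) - y))) = exp (- (real t * y)) * real n ^ t"
  proof -
    have "real n ^ t = exp (real t * ln (real n))"
      using n by (simp add: exp_of_nat_mult)
    then show ?thesis by (simp add: exp_add[symmetric] algebra_simps)
  qed
  finally show ?thesis by (simp add: mult.assoc)
qed

text \<open>The powers of \<open>n\<close> cancel, leaving a bound uniform in \<open>n\<close> in
  which \<open>t\<close> can be made as large as desired.\<close>

lemma (in prob_space) coupon_sum_lower_tail_fact:
  fixes X :: "nat \<Rightarrow> 'a \<Rightarrow> real"
  assumes n: "n \<ge> 1" and ind: "indep_vars (\<lambda>_. borel) X {1..n}"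
    and geo: "\<And>k. k \<in> {1..n} \<Longrightarrow> geometrically_distributed M (X k) (coupon_p n k)"
  shows "prob {\<omega> \<in> space M. (\<Sum>k=1..n. X k \<omega>) \<le> real n * (ln (real n) - y)}
    \<le> exp (- (real t * y)) * fact t"
proof -
  have "real n ^ t * (\<Prod>k\<in>{1..n}. real (n + 1 - k) / (real (n + 1 - k) + real t)) \<le> fact t"
    using prod_ratio_add_nat_le[OF n, of t] n
    by (subst prod_coupon_reindex[of "\<lambda>j. real j / (real j + real t)"]) (simp add: field_simps)
  then show ?thesis
    by (intro order_trans[OF coupon_sum_lower_tail[OF n ind geo order_refl, of _ t]] mult_left_mono)
       auto
qed

text \<open>The event contains the intersection of two independent ones: the last summand exceeds
  \<open>n * (y + 2)\<close>, and the sum of the others exceeds \<open>n * (ln n - 2)\<close>. The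
  latter has probability at least \<open>1 / 2\<close>, and the former supplies the
  exponential.\<close>

lemma (in prob_space) coupon_sum_upper_tail_ge:
  fixes X :: "nat \<Rightarrow> 'a \<Rightarrow> real"
  assumes n: "n \<ge> 2" and ind: "indep_vars (\<lambda>_. borel) X {1..n}"
    and geo: "\<And>k. k \<in> {1..n} \<Longrightarrow> geometrically_distributed M (X k) (coupon_p n k)"
    and y: "0 \<le> y"
  shows "exp (- ((y + 2) * (real n / (real n - 1)))) / 2
    \<le> prob {\<omega> \<in> space M. real n * (ln (real n) + y) \<le> (\<Sum>k=1..n. X k \<omega>)}"
proof -
  have n1: "n \<ge> 1" using n by simp
  have rv: "\<And>k. k \<in> {1..n} \<Longrightarrow> X k \<in> borel_measurable M"
    using geo by (simp add: geometrically_distributed_def)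
  note [measurable] = rv
  have ins: "{1..n} = insert n {1..<n}" using n by auto
  define S where "S \<omega> = (\<Sum>k\<in>{1..<n}. X k \<omega>)" for \<omega>
  have [measurable]: "S \<in> borel_measurable M" "X n \<in> borel_measurable M"
    using rv n unfolding S_def by (auto intro!: borel_measurable_sum)
  have indS: "indep_var borel (X n) borel S"
    unfolding S_def using ind ins by (intro indep_vars_sum) auto
  \<comment> \<open>The lower tail bound is used with \<open>t = 1\<close>. Omitting
    \<open>k = n\<close> removes the factor \<open>1 / 2\<close> from the full product
    \<open>1 / (n + 1)\<close>.\<close>
  have "(\<Prod>k\<in>{1..n}. real (n + 1 - k) / (real (n + 1 - k) + real 1)) = 1 / (real n + 1)"
    by (subst prod_coupon_reindex[of "\<lambda>j. real j / (real j + real 1)"], subst prod_ratio_add_nat) simp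
  then have "(\<Prod>k\<in>{1..<n}. real (n + 1 - k) / (real (n + 1 - k) + real 1)) = 2 / (real n + 1)"
    unfolding ins by (subst (asm) prod.insert) (auto simp: field_simps)
  then have "prob {\<omega> \<in> space M. S \<omega> \<le> real n * (ln (real n) - 2)}
      \<le> exp (- 2) * (real n * (2 / (real n + 1)))"
    using coupon_sum_lower_tail[OF n1 ind geo, of "{1..<n}" 2 1] by (simp add: S_def subset_eq)
  also have "\<dots> \<le> exp (- 2) * 2"
    by (intro mult_left_mono) (auto simp: field_simps)
  \<comment> \<open>The offset 2 is large enough here because \<open>exp 1 \<ge> 2\<close>.\<close>
  also have "\<dots> \<le> 1 / 2"
  proof -
    have "(4::real) = 2 * 2" by simp
    also have "\<dots> \<le> exp 1 * exp (1::real)"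
      using exp_ge_add_one_self[of "1::real"] by (intro mult_mono) auto
    also have "\<dots> = exp 2" by (simp add: exp_add[symmetric])
    finally show ?thesis by (simp add: exp_minus field_simps)
  qed
  finally have "prob {\<omega> \<in> space M. \<not> real n * (ln (real n) - 2) < S \<omega>} \<le> 1 / 2"
    by (simp add: not_less)
  then have PS: "1 / 2 \<le> prob {\<omega> \<in> space M. real n * (ln (real n) - 2) < S \<omega>}"
    by (subst (asm) prob_neg) auto
  define r where "r = real n * (y + 2)"
  \<comment> \<open>Rounding down serves both directions: \<open>m + 1 > r\<close> makes the tail
    event force \<open>X n > r\<close>, while \<open>m \<le> r\<close> keeps its probability at
    least \<open>exp (- (r / (n - 1)))\<close>.\<close>
  define m where "m = nat \<lfloor>r\<rfloor>"
  have r: "0 \<le> r" using y n by (simp add: r_def)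
  then have m: "real m \<le> r" "r < real m + 1" by (auto simp: m_def)
  have pn: "coupon_p n n = 1 / real n" using n by (simp add: coupon_p_def field_simps)
  \<comment> \<open>Chosen so that \<open>1 + ?c\<close> is the reciprocal of
    \<open>1 - 1 / n\<close>.\<close>
  let ?c = "1 / (real n - 1)"
  have "exp (- ?c) \<le> 1 - 1 / real n"
  proof -
    have "inverse (exp ?c) \<le> inverse (1 + ?c)"
      using n by (intro le_imp_inverse_le) (auto simp: add_pos_nonneg)
    also have "\<dots> = 1 - 1 / real n" using n by (simp add: field_simps)
    finally show ?thesis by (simp add: exp_minus)
  qed
  then have "exp (- ?c) ^ m \<le> (1 - 1 / real n) ^ m"
    by (intro power_mono) auto
  also have "\<dots> \<le> prob {\<omega> \<in> space M. real m + 1 \<le> X n \<omega>}"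
    using geometric_tail_ge[OF geo[of n], of m] n by (simp add: pn)
  finally have "exp (- ?c) ^ m \<le> prob {\<omega> \<in> space M. real m + 1 \<le> X n \<omega>}" .
  moreover have "exp (- (r * ?c)) \<le> exp (- ?c) ^ m"
    using m n by (simp add: exp_of_nat_mult[symmetric] divide_right_mono)
  ultimately have PX: "exp (- (r * ?c)) \<le> prob {\<omega> \<in> space M. real m + 1 \<le> X n \<omega>}"
    by simp
  have "r * ?c = (y + 2) * (real n / (real n - 1))" by (simp add: r_def)
  then have "exp (- ((y + 2) * (real n / (real n - 1)))) / 2 = exp (- (r * ?c)) * (1 / 2)"
    by (simp only: times_divide_eq_right mult_1_right)
  also have "\<dots> \<le> prob {\<omega> \<in> space M. real m + 1 \<le> X n \<omega>} *
      prob {\<omega> \<in> space M. real n * (ln (real n) - 2) < S \<omega>}"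
    by (intro mult_mono PX PS) auto
  also have "\<dots> = prob (X n -` {real m + 1..} \<inter> space M) *
      prob (S -` {real n * (ln (real n) - 2)<..} \<inter> space M)"
    by (intro arg_cong2[where f = "(*)"] arg_cong[where f = prob]) auto
  also have "\<dots> = prob ((\<lambda>\<omega>. (X n \<omega>, S \<omega>)) -` ({real m + 1..} \<times> {real n * (ln (real n) - 2)<..})
      \<inter> space M)"
    by (rule indep_varD[OF indS, symmetric]) auto
  also have "\<dots> \<le> prob {\<omega> \<in> space M. real n * (ln (real n) + y) \<le> (\<Sum>k=1..n. X k \<omega>)}"
  proof (rule finite_measure_mono)
    have "(\<Sum>k=1..n. X k \<omega>) = X n \<omega> + S \<omega>" for \<omega>
      unfolding S_def ins by simp
    then show "(\<lambda>\<omega>. (X n \<omega>, S \<omega>)) -` ({real m + 1..} \<times> {real n * (ln (real n) - 2)<..}) \<inter> space M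
      \<subseteq> {\<omega> \<in> space M. real n * (ln (real n) + y) \<le> (\<Sum>k=1..n. X k \<omega>)}"
      using m by (auto simp: r_def algebra_simps)
  qed measurable
  finally show ?thesis .
qed

section \<open>From exponential bounds to limits of scaled logarithms\<close>

lemma limsup_scaled_elog_le:
  fixes P a :: "nat \<Rightarrow> real"
  assumes a: "\<forall>\<^sub>F n in sequentially. 0 < a n" "a \<longlonglongrightarrow> 0" and K: "0 < K"
    and P: "\<And>n. 0 \<le> P n" "\<forall>\<^sub>F n in sequentially. P n \<le> K * exp (- (c / a n))"
  shows "limsup (\<lambda>n. ereal (a n) * elog (P n)) \<le> ereal (- c)"
proof -
  \<comment> \<open>The prefactor \<open>K\<close> contributes only \<open>a n * ln K\<close>, which
    tends to 0.\<close>
  have "limsup (\<lambda>n. ereal (a n) * elog (P n)) \<le> limsup (\<lambda>n. ereal (a n * ln K - c))"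
  proof (rule Limsup_mono)
    show "\<forall>\<^sub>F n in sequentially. ereal (a n) * elog (P n) \<le> ereal (a n * ln K - c)"
      using a(1) P(2)
    proof eventually_elim
      case (elim n)
      show ?case
      \<comment> \<open>For \<open>P n = 0\<close> the left-hand side is minus infinity, because
        \<open>a n > 0\<close>.\<close>
      proof (cases "P n = 0")
        case False
        then have "0 < P n" using P(1)[of n] by simp
        then have "ln (P n) \<le> ln (K * exp (- (c / a n)))" using elim by simp
        also have "\<dots> = ln K - c / a n" using K by (simp add: ln_mult)
        finally have "a n * ln (P n) \<le> a n * (ln K - c / a n)"
          using elim by (intro mult_left_mono) auto
        also have "\<dots> = a n * ln K - c" using elim by (simp add: algebra_simps)
        finally show ?thesis using False by (simp add: elog_def)
      qed (use elim in \<open>simp add: elog_def\<close>)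
    qed
  qed
  also have "(\<lambda>n. ereal (a n * ln K - c)) \<longlonglongrightarrow> ereal (0 * ln K - c)"
    by (intro tendsto_intros a)
  then have "limsup (\<lambda>n. ereal (a n * ln K - c)) = ereal (- c)"
    by (subst lim_imp_Limsup) auto
  finally show ?thesis .
qed

lemma liminf_scaled_elog_ge:
  fixes P a :: "nat \<Rightarrow> real"
  assumes a: "\<forall>\<^sub>F n in sequentially. 0 < a n" "a \<longlonglongrightarrow> 0" and K: "0 < K"
    and P: "\<forall>\<^sub>F n in sequentially. K * exp (- (c / a n)) \<le> P n"
  shows "ereal (- c) \<le> liminf (\<lambda>n. ereal (a n) * elog (P n))"
proof -
  have "(\<lambda>n. ereal (a n * ln K - c)) \<longlonglongrightarrow> ereal (0 * ln K - c)"
    by (intro tendsto_intros a)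
  then have "ereal (- c) = liminf (\<lambda>n. ereal (a n * ln K - c))"
    by (subst lim_imp_Liminf) auto
  also have "\<dots> \<le> liminf (\<lambda>n. ereal (a n) * elog (P n))"
  proof (rule Liminf_mono)
    show "\<forall>\<^sub>F n in sequentially. ereal (a n * ln K - c) \<le> ereal (a n) * elog (P n)"
      using a(1) P
    proof eventually_elim
      case (elim n)
      have pos: "0 < K * exp (- (c / a n))" using K by simp
      with elim have "P n > 0" by linarith
      have "ln K - c / a n = ln (K * exp (- (c / a n)))" using K by (simp add: ln_mult)
      also have "\<dots> \<le> ln (P n)" using elim pos \<open>P n > 0\<close> by simp
      finally have "a n * (ln K - c / a n) \<le> a n * ln (P n)"
        using elim by (intro mult_left_mono) auto
      moreover have "a n * (ln K - c / a n) = a n * ln K - c"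
        using elim by (simp add: algebra_simps)
      ultimately show ?case using \<open>P n > 0\<close> by (simp add: elog_def)
    qed
  qed
  finally show ?thesis .
qed

section \<open>The large deviation principle for the rescaled collection time\<close>

theorem proposition5p1:
  fixes M :: "'a measure"
    and X :: "nat \<Rightarrow> nat \<Rightarrow> 'a \<Rightarrow> real"
    and a :: "nat \<Rightarrow> real"
  assumes "prob_space M"
    and "\<And>n. n \<ge> 1 \<Longrightarrow> prob_space.indep_vars M (\<lambda>_. borel) (X n) {1..n}"
    and "\<And>n k. n \<ge> 1 \<Longrightarrow> k \<in> {1..n} \<Longrightarrow>
           geometrically_distributed M (X n k) (coupon_p n k)"
    and "\<And>n. n \<ge> 2 \<Longrightarrow> a n > 0"
    and "a \<longlonglongrightarrow> 0"
    and "filterlim (\<lambda>n. a n * ln (real n)) at_top sequentially"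
  shows "satisfies_LDP M 2
           (\<lambda>n \<omega>. a n * ln (real n) * (coupon_T X n \<omega> / (real n * ln (real n)) - 1))
           (\<lambda>n. 1 / a n) I_MD"
proof -
  interpret prob_space M by fact
  note ind = assms(2) and geo = assms(3) and apos = assms(4) and alim = assms(5)
  define Z where
    "Z n \<omega> = a n * ln (real n) * (coupon_T X n \<omega> / (real n * ln (real n)) - 1)" for n \<omega>
  define T where "T n \<omega> = (\<Sum>k=1..n. X n k \<omega>)" for n \<omega>
  have apos_ev: "\<forall>\<^sub>F n in sequentially. 0 < a n"
    using apos by (auto intro: eventually_sequentiallyI[of 2])
  have n2: "\<forall>\<^sub>F n in sequentially. 2 \<le> (n::nat)"
    by (rule eventually_ge_at_top)
  have [measurable]: "Z n \<in> borel_measurable M" for n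
    unfolding Z_def coupon_T_def using geo
    by (cases "n \<ge> 1")
       (auto simp: geometrically_distributed_def intro!: borel_measurable_sum borel_measurable_times
         borel_measurable_diff borel_measurable_divide)
  \<comment> \<open>A level \<open>x\<close> of \<open>Z n\<close> is the level
    \<open>y = x / a n\<close> of \<open>T n / n - ln n\<close>, so bounds exponential in
    \<open>y\<close> acquire the speed \<open>1 / a n\<close>.\<close>
  have Zge: "x \<le> Z n \<omega> \<longleftrightarrow> real n * (ln (real n) + x / a n) \<le> T n \<omega>"
    and Zle: "Z n \<omega> \<le> x \<longleftrightarrow> T n \<omega> \<le> real n * (ln (real n) + x / a n)"
    if n: "n \<ge> 2" for n \<omega> x
  proof -
    have pos: "0 < a n" "0 < ln (real n)" "0 < real n" using n apos by auto
    then have T_eq: "T n \<omega> = real n * (ln (real n) + Z n \<omega> / a n)"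
      by (simp add: Z_def T_def coupon_T_def field_simps)
    show "x \<le> Z n \<omega> \<longleftrightarrow> real n * (ln (real n) + x / a n) \<le> T n \<omega>"
      "Z n \<omega> \<le> x \<longleftrightarrow> T n \<omega> \<le> real n * (ln (real n) + x / a n)"
      unfolding T_eq using pos by (auto simp: divide_le_cancel)
  qed
  have upper: "prob {\<omega> \<in> space M. x \<le> Z n \<omega>} \<le> exp (- (\<theta> * x / a n)) / (1 - \<theta>)"
    if "n \<ge> 2" "0 \<le> \<theta>" "\<theta> < 1" for n x \<theta>
    using coupon_sum_upper_tail[of n "X n" \<theta> "x / a n"] ind geo that by (simp add: Zge T_def)
  have lower: "prob {\<omega> \<in> space M. Z n \<omega> \<le> - x} \<le> exp (- (real t * x / a n)) * fact t"
    if "n \<ge> 2" for n x t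
    using coupon_sum_lower_tail_fact[of n "X n" "x / a n" t] ind geo that by (simp add: Zle T_def)
  have upper_ge: "exp (- ((x / a n + 2) * (real n / (real n - 1)))) / 2
      \<le> prob {\<omega> \<in> space M. x \<le> Z n \<omega>}" if "n \<ge> 2" "0 \<le> x" for n x
    using coupon_sum_upper_tail_ge[of n "X n" "x / a n"] ind geo that apos[of n]
    by (simp add: Zge T_def)

  have "filterlim (\<lambda>n. 1 / a n) at_top sequentially"
    using alim apos_ev
    by (auto simp: divide_inverse filterlim_at intro!: filterlim_inverse_at_top)
  moreover have "limsup (\<lambda>n. ereal (a n) * elog (prob {\<omega> \<in> space M. Z n \<omega> \<in> C})) \<le> - (INF x\<in>C. I_MD x)"
    if C: "closed C" for C
  proof -
    let ?P = "\<lambda>n. prob {\<omega> \<in> space M. Z n \<omega> \<in> C}"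
    have [measurable]: "C \<in> sets borel" using C by simp
    \<comment> \<open>Working with real \<open>c\<close> strictly below the infimum also covers an
      infinite infimum, for instance when \<open>C\<close> has no nonnegative point.\<close>
    have bound: "limsup (\<lambda>n. ereal (a n) * elog (?P n)) \<le> ereal (- c)"
      if c: "ereal c < (INF x\<in>C. I_MD x)" for c
    proof (cases "c < 0")
      case True
      \<comment> \<open>For negative \<open>c\<close> it suffices that probabilities are at most
        1.\<close>
      have "limsup (\<lambda>n. ereal (a n) * elog (?P n)) \<le> ereal (- 0)"
        by (rule limsup_scaled_elog_le[where K = 1]) (use apos_ev alim in auto)
      also have "\<dots> \<le> ereal (- c)" using True by simp
      finally show ?thesis .
    next
      case False
      then have c0: "0 \<le> c" by simp
      \<comment> \<open>The gap between \<open>c\<close> and \<open>c'\<close> leaves room for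
        \<open>\<theta> = c / c' < 1\<close>, with rate \<open>\<theta> * c' = c\<close> at level
        \<open>c'\<close>.\<close>
      obtain c' where c': "c < c'" "ereal c' < (INF x\<in>C. I_MD x)"
        using ereal_dense2[OF c] by auto
      have Cx: "c' \<le> x" if "x \<in> C" "0 \<le> x" for x
      proof -
        have "(INF x\<in>C. I_MD x) \<le> I_MD x" using that by (intro INF_lower)
        with c'(2) have "ereal c' < I_MD x" by (rule less_le_trans)
        then show ?thesis using that by (simp add: I_MD_def)
      qed
      \<comment> \<open>Since \<open>c' > 0\<close>, the origin lies outside the closed set
        \<open>C\<close>. So the negative part of \<open>C\<close> stays below some
        \<open>- d\<close>, and \<open>t\<close> with \<open>t * d \<ge> c\<close> makes its decay
        fast enough.\<close>
      have "0 \<in> - C" using Cx[of 0] c0 c' by auto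
      then obtain d where d: "0 < d" "ball 0 d \<subseteq> - C"
        using C open_contains_ball[of "- C"] by auto
      obtain t :: nat where "c / d < real t" using reals_Archimedean2 by blast
      then have t: "c \<le> real t * d" using d by (simp add: field_simps)
      define \<theta> where "\<theta> = c / c'"
      have \<theta>: "0 \<le> \<theta>" "\<theta> < 1" "\<theta> * c' = c" using c0 c' by (auto simp: \<theta>_def)
      have split: "x \<le> - d \<or> c' \<le> x" if "x \<in> C" for x
      proof (cases "0 \<le> x")
        case False
        moreover have "x \<notin> ball 0 d" using that d by auto
        ultimately show ?thesis by (auto simp: dist_real_def)
      qed (use Cx that in auto)
      show ?thesis
      proof (rule limsup_scaled_elog_le[where K = "1 / (1 - \<theta>) + fact t"])
        show "\<forall>\<^sub>F n in sequentially. ?P n \<le> (1 / (1 - \<theta>) + fact t) * exp (- (c / a n))"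
          using n2
        proof eventually_elim
          case (elim n)
          have an: "0 < a n" using apos elim by simp
          have "?P n \<le> prob ({\<omega> \<in> space M. c' \<le> Z n \<omega>} \<union> {\<omega> \<in> space M. Z n \<omega> \<le> - d})"
            using split by (intro finite_measure_mono) auto
          also have "\<dots> \<le> prob {\<omega> \<in> space M. c' \<le> Z n \<omega>} + prob {\<omega> \<in> space M. Z n \<omega> \<le> - d}"
            by (intro measure_Un_le) measurable
          also have "\<dots> \<le> exp (- (\<theta> * c' / a n)) / (1 - \<theta>) + exp (- (real t * d / a n)) * fact t"
            by (intro add_mono upper lower elim \<theta>)
          also have "\<dots> \<le> exp (- (c / a n)) / (1 - \<theta>) + exp (- (c / a n)) * fact t"
            unfolding \<theta> using t an
            by (intro add_mono mult_right_mono) (auto intro: divide_right_mono)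
          also have "\<dots> = (1 / (1 - \<theta>) + fact t) * exp (- (c / a n))"
            by (simp add: algebra_simps)
          finally show ?case .
        qed
        show "0 < 1 / (1 - \<theta>) + (fact t :: real)"
          using \<theta> by (intro add_pos_pos) auto
      qed (use apos_ev alim in auto)
    qed
    show ?thesis
    proof (rule ccontr)
      assume "\<not> ?thesis"
      then obtain z where z: "- (INF x\<in>C. I_MD x) < ereal z"
          "ereal z < limsup (\<lambda>n. ereal (a n) * elog (?P n))"
        using ereal_dense2 by (meson not_le)
      from z(1) have "ereal (- z) < (INF x\<in>C. I_MD x)"
        using ereal_uminus_less_reorder by fastforce
      from bound[OF this] z(2) show False by simp
    qed
  qed
  moreover have "- (INF x\<in>U. I_MD x) \<le> liminf (\<lambda>n. ereal (a n) * elog (prob {\<omega> \<in> space M. Z n \<omega> \<in> U}))"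
    if U: "open U" for U
  proof -
    let ?P = "\<lambda>n. prob {\<omega> \<in> space M. Z n \<omega> \<in> U}"
    let ?L = "liminf (\<lambda>n. ereal (a n) * elog (?P n))"
    have [measurable]: "U \<in> sets borel" using U by simp
    \<comment> \<open>The infimum over \<open>U\<close> is treated pointwise; at negative
      \<open>x\<close> the rate is infinite.\<close>
    have "- ?L \<le> I_MD x" if x: "x \<in> U" for x
    proof (cases "0 \<le> x")
      case True
      obtain d where d: "0 < d" "ball x d \<subseteq> U" using U x open_contains_ball by blast
      have "ereal (- x) \<le> ?L + ereal \<epsilon>" if \<epsilon>: "0 < \<epsilon>" for \<epsilon>
      proof -
        \<comment> \<open>The mass is located in the window from \<open>x + e\<close> to
          \<open>x + 4 * e\<close>, inside the ball. Exceeding \<open>x + e\<close> has probability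
          at least of rate \<open>x + 2 * e\<close>; exceeding \<open>x + 4 * e\<close> decays at
          rate \<open>x + 3 * e\<close> by the choice of \<open>\<theta>\<close>, hence is
          negligible in comparison.\<close>
        define e where "e = min \<epsilon> d / 4"
        have e: "0 < e" "4 * e \<le> d" "4 * e \<le> \<epsilon>" using \<epsilon> d by (auto simp: e_def)
        define \<theta> where "\<theta> = (x + 3 * e) / (x + 4 * e)"
        have \<theta>: "0 \<le> \<theta>" "\<theta> < 1" "\<theta> * (x + 4 * e) = x + 3 * e"
          using True e by (auto simp: \<theta>_def)
        \<comment> \<open>This is the exponent in \<open>upper_ge\<close> at level
          \<open>x + e\<close>, multiplied by \<open>a n\<close>. The extra \<open>e\<close> in
          \<open>x + 2 * e\<close> absorbs both \<open>2 * a n\<close> and the factor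
          \<open>n / (n - 1)\<close>.\<close>
        have "(\<lambda>n. (x + e + 2 * a n) * (real n / (real n - 1))) \<longlonglongrightarrow> (x + e + 2 * 0) * 1"
          by (intro tendsto_intros alim) real_asymp
        then have ev1: "\<forall>\<^sub>F n in sequentially.
            (x + e + 2 * a n) * (real n / (real n - 1)) < x + 2 * e"
          using e by (intro order_tendstoD(2)) auto
        have "filterlim (\<lambda>n. e * (1 / a n)) at_top sequentially"
          by (rule filterlim_tendsto_pos_mult_at_top[OF tendsto_const e(1)]) fact
        then have "(\<lambda>n. exp (- (e * (1 / a n))) / (1 - \<theta>)) \<longlonglongrightarrow> 0 / (1 - \<theta>)"
          using \<theta> by (intro tendsto_intros filterlim_compose[OF exp_at_bot]
              filterlim_compose[OF filterlim_uminus_at_bot_at_top]) auto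
        then have ev2: "\<forall>\<^sub>F n in sequentially. exp (- (e * (1 / a n))) / (1 - \<theta>) < 1 / 4"
          by (intro order_tendstoD(2)) auto
        have "ereal (- (x + 2 * e)) \<le> ?L"
        proof (rule liminf_scaled_elog_ge[where K = "1 / 4"])
          \<comment> \<open>The constant is \<open>1 / 2 - 1 / 4\<close>: the lower bound for the
            upper tail at \<open>x + e\<close> minus the bound for the tail at
            \<open>x + 4 * e\<close>.\<close>
          show "\<forall>\<^sub>F n in sequentially. 1 / 4 * exp (- ((x + 2 * e) / a n)) \<le> ?P n"
            using n2 ev1 ev2
          proof eventually_elim
            case (elim n)
            have an: "0 < a n" using apos elim by simp
            let ?E = "exp (- ((x + 2 * e) / a n))"
            have "((x + e) / a n + 2) * (real n / (real n - 1))
                = (x + e + 2 * a n) * (real n / (real n - 1)) / a n"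
              using an by (simp add: field_simps)
            also have "\<dots> \<le> (x + 2 * e) / a n"
              using elim an by (intro divide_right_mono) auto
            finally have "?E / 2 \<le> exp (- (((x + e) / a n + 2) * (real n / (real n - 1)))) / 2"
              by simp
            also have "\<dots> \<le> prob {\<omega> \<in> space M. x + e \<le> Z n \<omega>}"
              using elim True e by (intro upper_ge) auto
            finally have lo: "?E / 2 \<le> prob {\<omega> \<in> space M. x + e \<le> Z n \<omega>}" .
            have "prob {\<omega> \<in> space M. x + 4 * e \<le> Z n \<omega>}
                \<le> exp (- (\<theta> * (x + 4 * e) / a n)) / (1 - \<theta>)"
              by (intro upper elim \<theta>)
            also have "\<dots> = ?E * (exp (- (e * (1 / a n))) / (1 - \<theta>))"
              unfolding \<theta> by (simp add: exp_add[symmetric] add_divide_distrib algebra_simps)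
            also have "\<dots> \<le> ?E * (1 / 4)"
              using elim by (intro mult_left_mono) auto
            finally have hi: "prob {\<omega> \<in> space M. x + 4 * e \<le> Z n \<omega>} \<le> ?E * (1 / 4)" .
            have "prob {\<omega> \<in> space M. x + e \<le> Z n \<omega>}
                \<le> prob ({\<omega> \<in> space M. Z n \<omega> \<in> U} \<union> {\<omega> \<in> space M. x + 4 * e \<le> Z n \<omega>})"
            proof (rule finite_measure_mono)
              have "z \<in> U" if "x + e \<le> z" "\<not> x + 4 * e \<le> z" for z
                using that e d by (auto simp: dist_real_def subset_eq)
              then show "{\<omega> \<in> space M. x + e \<le> Z n \<omega>}
                \<subseteq> {\<omega> \<in> space M. Z n \<omega> \<in> U} \<union> {\<omega> \<in> space M. x + 4 * e \<le> Z n \<omega>}"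
                by blast
            qed measurable
            also have "\<dots> \<le> ?P n + prob {\<omega> \<in> space M. x + 4 * e \<le> Z n \<omega>}"
              by (intro measure_Un_le) measurable
            finally show ?case using lo hi by simp
          qed
        qed (use apos_ev alim in auto)
        then have "ereal (- (x + 2 * e)) + ereal \<epsilon> \<le> ?L + ereal \<epsilon>"
          by (rule add_right_mono)
        moreover have "ereal (- x) \<le> ereal (- (x + 2 * e)) + ereal \<epsilon>"
          using e by simp
        ultimately show ?thesis by (rule order_trans[rotated])
      qed
      then have "ereal (- x) \<le> ?L" by (rule ereal_le_epsilon2)
      then have "- ?L \<le> ereal x" by (subst ereal_uminus_le_reorder) simp
      then show ?thesis using True by (simp add: I_MD_def)
    qed (simp add: I_MD_def)
    then have "- ?L \<le> (INF x\<in>U. I_MD x)" by (intro INF_greatest)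
    then show ?thesis by (subst ereal_uminus_le_reorder)
  qed
  ultimately show ?thesis
    unfolding satisfies_LDP_def Z_def[symmetric] using rate_function_I_MD by simp
qed

end
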